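(* Let $\omega$ be a non-principal ultrafilter on $\mathbb{N}$. Let $(Y^k)_{k\in I}$ be a countable collection of separable metric spaces and $(X_m,d_m,p_m)$ a sequence of complete pointed metric spaces with ultralimit $X_\omega$. Let $f_m^k\colon Y^k\to X_m$ be continuous maps for $m\in\mathbb{N}$ and $k\in I$, and suppose that for each $k\in I$ the sequence $(f_m^k)_{m}$ is equi-continuous and equi-bounded; let $f_\omega^k\colon Y^k\to X_\omega$ denote its pointwise ultralimit. Then: (1) there exist a complete metric space $Z$, a subsequence $(m_l)$, and isometric embeddings $\iota_l\colon X_{m_l}\to Z$ such that, for each $k\in I$, the sequence $(\iota_l\circ f_{m_l}^k)_l$ converges to a continuous map $f_\infty^k\colon Y^k\to Z$ pointwise everywhere and uniformly on compact sets; (2) there exists an isometric embedding $\eta\colon C\to X_\omega$, where $C=\overline{\bigcup_{k\in I}f_\infty^k(Y^k)}\subset Z$, such that $f_\omega^k=\eta\circ f_\infty^k$ for every $k\in I$. Moreover, given subsets $\mathbb{N}\supset\mathcal F_1\supset\mathcal F_2\supset\cdots$ satisfying $\omega(\mathcal F_m)=1$ for all $m$, the subsequence $(m_l)$ can be chosen so that $m_l\in\mathcal F_{N_l}$ for a strictly increasing sequence $(N_l)$.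
   Context: A non-principal ultrafilter $\omega$ on $\mathbb{N}$ is a finitely additive measure $\omega\colon\mathcal P(\mathbb{N})\to\{0,1\}$ with $\omega(\mathbb{N})=1$ and $\omega(F)=0$ for finite $F$. For a bounded real sequence, $\lim_\omega r_m$ is the unique $t$ with $\omega(\{m:|r_m-t|<\varepsilon\})=1$ for every $\varepsilon>0$. For pointed metric spaces $(X_m,d_m,p_m)$, the ultralimit $X_\omega$ is the set of classes $[x_m]$ of sequences $x_m\in X_m$ with $\sup_m d_m(x_m,p_m)<\infty$, where $(x_m)\sim(y_m)$ iff $\lim_\omega d_m(x_m,y_m)=0$, with metric $d_\omega([x_m],[y_m])=\lim_\omega d_m(x_m,y_m)$. A sequence of maps $f_m\colon Y\to X_m$ is equi-continuous if for every $\varepsilon>0$ there is $\delta>0$ such that $d(x,y)<\delta$ implies $d_m(f_m(x),f_m(y))<\varepsilon$ for all $x,y\in Y$ and all $m$; it is equi-bounded if there is $\lambda>0$ with $f_m(Y)\subset\overline B_{X_m}(p_m,\lambda)$ for all $m$. The pointwise ultralimit of such a sequence is $f_\omega\colon Y\to X_\omega$, $f_\omega(y)=[f_m(y)]$. An isometric embedding is a distance-preserving map (not necessarily surjective). *)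

theory Defs
  imports "HOL-Analysis.Analysis"
begin

section \<open>Ultrafilters and ultralimits of real sequences\<close>

definition nonprincipal_ultrafilter :: "(nat set \<Rightarrow> real) \<Rightarrow> bool" where
  "nonprincipal_ultrafilter \<omega> \<longleftrightarrow>
     range \<omega> \<subseteq> {0, 1} \<and> additive UNIV \<omega> \<and> \<omega> UNIV = 1 \<and> (\<forall>F. finite F \<longrightarrow> \<omega> F = 0)"

definition ultra_lim :: "(nat set \<Rightarrow> real) \<Rightarrow> (nat \<Rightarrow> real) \<Rightarrow> real" where
  "ultra_lim \<omega> r = (THE t. \<forall>\<epsilon>>0. \<omega> {m. \<bar>r m - t\<bar> < \<epsilon>} = 1)"


section \<open>Ultralimits of pointed metric spaces\<close>

definition bounded_seqs :: "(nat \<Rightarrow> 'x metric) \<Rightarrow> (nat \<Rightarrow> 'x) \<Rightarrow> (nat \<Rightarrow> 'x) set" where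
  "bounded_seqs X p = {x. (\<forall>m. x m \<in> mspace (X m)) \<and>
                          bdd_above (range (\<lambda>m. mdist (X m) (x m) (p m)))}"

definition ultra_rel ::
    "(nat set \<Rightarrow> real) \<Rightarrow> (nat \<Rightarrow> 'x metric) \<Rightarrow> (nat \<Rightarrow> 'x) \<Rightarrow> ((nat \<Rightarrow> 'x) \<times> (nat \<Rightarrow> 'x)) set" where
  "ultra_rel \<omega> X p = {(x, y). x \<in> bounded_seqs X p \<and> y \<in> bounded_seqs X p \<and>
                              ultra_lim \<omega> (\<lambda>m. mdist (X m) (x m) (y m)) = 0}"

definition ultra_class ::
    "(nat set \<Rightarrow> real) \<Rightarrow> (nat \<Rightarrow> 'x metric) \<Rightarrow> (nat \<Rightarrow> 'x) \<Rightarrow> (nat \<Rightarrow> 'x) \<Rightarrow> (nat \<Rightarrow> 'x) set" where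
  "ultra_class \<omega> X p x = ultra_rel \<omega> X p `` {x}"

text \<open>The distance of two classes is the common value of the ultralimits over all pairs of
  representatives; see \<open>mdist_ultralimit\<close> below for well-definedness. It is set to 0 off the
  carrier because \<open>Metric_space\<close> requires nonnegativity and symmetry for arbitrary arguments.\<close>

definition ultra_dist ::
    "(nat set \<Rightarrow> real) \<Rightarrow> (nat \<Rightarrow> 'x metric) \<Rightarrow> (nat \<Rightarrow> 'x) \<Rightarrow> (nat \<Rightarrow> 'x) set \<Rightarrow> (nat \<Rightarrow> 'x) set \<Rightarrow> real" where
  "ultra_dist \<omega> X p A B =
     (if A \<in> bounded_seqs X p // ultra_rel \<omega> X p \<and> B \<in> bounded_seqs X p // ultra_rel \<omega> X p
      then the_elem ((\<lambda>(x, y). ultra_lim \<omega> (\<lambda>m. mdist (X m) (x m) (y m))) ` (A \<times> B))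
      else 0)"

definition ultralimit ::
    "(nat set \<Rightarrow> real) \<Rightarrow> (nat \<Rightarrow> 'x metric) \<Rightarrow> (nat \<Rightarrow> 'x) \<Rightarrow> (nat \<Rightarrow> 'x) set metric" where
  "ultralimit \<omega> X p = metric (bounded_seqs X p // ultra_rel \<omega> X p, ultra_dist \<omega> X p)"

definition pointwise_ultralimit ::
    "(nat set \<Rightarrow> real) \<Rightarrow> (nat \<Rightarrow> 'x metric) \<Rightarrow> (nat \<Rightarrow> 'x) \<Rightarrow> (nat \<Rightarrow> 'y \<Rightarrow> 'x) \<Rightarrow> 'y \<Rightarrow> (nat \<Rightarrow> 'x) set" where
  "pointwise_ultralimit \<omega> X p f y = ultra_class \<omega> X p (\<lambda>m. f m y)"


section \<open>Sequences of maps\<close>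

definition equi_continuous ::
    "'y metric \<Rightarrow> (nat \<Rightarrow> 'x metric) \<Rightarrow> (nat \<Rightarrow> 'y \<Rightarrow> 'x) \<Rightarrow> bool" where
  "equi_continuous Y X f \<longleftrightarrow>
     (\<forall>\<epsilon>>0. \<exists>\<delta>>0. \<forall>x\<in>mspace Y. \<forall>y\<in>mspace Y. \<forall>m.
        mdist Y x y < \<delta> \<longrightarrow> mdist (X m) (f m x) (f m y) < \<epsilon>)"

definition equi_bounded ::
    "'y metric \<Rightarrow> (nat \<Rightarrow> 'x metric) \<Rightarrow> (nat \<Rightarrow> 'x) \<Rightarrow> (nat \<Rightarrow> 'y \<Rightarrow> 'x) \<Rightarrow> bool" where
  "equi_bounded Y X p f \<longleftrightarrow> (\<exists>L>0. \<forall>m. f m ` mspace Y \<subseteq> mcball_of (X m) (p m) L)"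

definition isometric_embedding :: "'a metric \<Rightarrow> 'b metric \<Rightarrow> ('a \<Rightarrow> 'b) \<Rightarrow> bool" where
  "isometric_embedding M N h \<longleftrightarrow>
     h \<in> mspace M \<rightarrow> mspace N \<and>
     (\<forall>x\<in>mspace M. \<forall>y\<in>mspace M. mdist N (h x) (h y) = mdist M x y)"

definition converges_pointwise ::
    "'a metric \<Rightarrow> 'b metric \<Rightarrow> (nat \<Rightarrow> 'a \<Rightarrow> 'b) \<Rightarrow> ('a \<Rightarrow> 'b) \<Rightarrow> bool" where
  "converges_pointwise Y Z h g \<longleftrightarrow>
     (\<forall>y\<in>mspace Y. limitin (mtopology_of Z) (\<lambda>l. h l y) (g y) sequentially)"

definition converges_uniformly_on_compacts ::
    "'a metric \<Rightarrow> 'b metric \<Rightarrow> (nat \<Rightarrow> 'a \<Rightarrow> 'b) \<Rightarrow> ('a \<Rightarrow> 'b) \<Rightarrow> bool" where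
  "converges_uniformly_on_compacts Y Z h g \<longleftrightarrow>
     (\<forall>K. compactin (mtopology_of Y) K \<longrightarrow>
        (\<forall>\<epsilon>>0. \<forall>\<^sub>F l in sequentially. \<forall>y\<in>K. mdist Z (h l y) (g y) < \<epsilon>))"

text \<open>Type of the points of the common target space \<open>Z\<close>: HOL cannot quantify existentially over types.
  Fixing this one loses no generality. Only the closure of the union of the countably many isometric
  copies of the spaces \<open>X\<close> in \<open>Z\<close> matters, and its points \<open>z\<close> are faithfully represented by the
  functions sending \<open>(l, x)\<close> to the distance between \<open>z\<close> and the \<open>l\<close>-th copy of \<open>x\<close>.\<close>

type_synonym 'x common_point = "nat \<times> 'x \<Rightarrow> real"


section \<open>Well-definedness\<close>

context
  fixes \<omega> :: "nat set \<Rightarrow> real"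
  assumes ultra: "nonprincipal_ultrafilter \<omega>"
begin

lemma ultra_01: "\<omega> A = 0 \<or> \<omega> A = 1"
  using ultra by (auto simp: nonprincipal_ultrafilter_def)

lemma ultra_Un: "A \<inter> B = {} \<Longrightarrow> \<omega> (A \<union> B) = \<omega> A + \<omega> B"
  using ultra by (auto simp: nonprincipal_ultrafilter_def additive_def)

lemma ultra_UNIV: "\<omega> UNIV = 1"
  using ultra by (auto simp: nonprincipal_ultrafilter_def)

lemma ultra_finite: "finite A \<Longrightarrow> \<omega> A = 0"
  using ultra by (auto simp: nonprincipal_ultrafilter_def)

lemma ultra_mono: "\<omega> A = 1 \<Longrightarrow> A \<subseteq> B \<Longrightarrow> \<omega> B = 1"
  using ultra_Un[of A "B - A"] ultra_01[of B] ultra_01[of "B - A"]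
  by (auto simp: Un_absorb1)

lemma ultra_Compl: "\<omega> (- A) = 1 - \<omega> A"
  using ultra_Un[of A "- A"] ultra_UNIV by auto

lemma ultra_Int:
  assumes "\<omega> A = 1" "\<omega> B = 1"
  shows "\<omega> (A \<inter> B) = 1"
proof -
  have "\<omega> A = \<omega> (A \<inter> B) + \<omega> (A - B)"
    using ultra_Un[of "A \<inter> B" "A - B"] by (simp add: Int_Diff_Un Int_Diff_disjoint)
  moreover have "\<omega> (A - B) \<noteq> 1"
    using ultra_mono[of "A - B" "- B"] ultra_Compl[of B] assms by auto
  ultimately show ?thesis
    using ultra_01[of "A - B"] assms by auto
qed

lemma ultra_eventually:
  "eventually P (Abs_filter (\<lambda>P. \<omega> {m. P m} = 1)) \<longleftrightarrow> \<omega> {m. P m} = 1"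
proof (rule eventually_Abs_filter, rule is_filter.intro)
  show "\<omega> {m. True} = 1"
    by (simp add: ultra_UNIV)
  show "\<omega> {m. P m \<and> Q m} = 1" if "\<omega> {m. P m} = 1" "\<omega> {m. Q m} = 1" for P Q
    using ultra_Int[OF that] by (simp add: Collect_conj_eq)
  show "\<omega> {m. Q m} = 1" if "\<forall>m. P m \<longrightarrow> Q m" "\<omega> {m. P m} = 1" for P Q
    by (rule ultra_mono[OF that(2)]) (use that(1) in auto)
qed

lemma ultra_tendsto_iff:
  fixes r :: "nat \<Rightarrow> real"
  shows "(r \<longlongrightarrow> t) (Abs_filter (\<lambda>P. \<omega> {m. P m} = 1)) \<longleftrightarrow> (\<forall>\<epsilon>>0. \<omega> {m. \<bar>r m - t\<bar> < \<epsilon>} = 1)"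
  by (simp add: tendsto_iff dist_real_def ultra_eventually)

lemma ultra_not_bot: "Abs_filter (\<lambda>P. \<omega> {m. P m} = 1) \<noteq> bot"
  using ultra_eventually[of "\<lambda>_. False"] ultra_finite[of "{}"]
  by (auto simp: trivial_limit_def)

lemma ultra_lim_eqI:
  assumes "\<forall>\<epsilon>>0. \<omega> {m. \<bar>r m - t\<bar> < \<epsilon>} = 1"
  shows "ultra_lim \<omega> r = t"
  unfolding ultra_lim_def
proof (rule the_equality)
  show "\<forall>\<epsilon>>0. \<omega> {m. \<bar>r m - t\<bar> < \<epsilon>} = 1" by (rule assms)
  show "s = t" if "\<forall>\<epsilon>>0. \<omega> {m. \<bar>r m - s\<bar> < \<epsilon>} = 1" for s
    using tendsto_unique[OF ultra_not_bot] that assms by (simp flip: ultra_tendsto_iff)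
qed

lemma ultra_lim_works:
  fixes r :: "nat \<Rightarrow> real"
  assumes bound: "\<And>m. \<bar>r m\<bar> \<le> B"
  shows "\<forall>\<epsilon>>0. \<omega> {m. \<bar>r m - ultra_lim \<omega> r\<bar> < \<epsilon>} = 1"
proof -
  define S where "S = {s. \<omega> {m. s \<le> r m} = 1}"
  have S_le: "s \<le> B" if "s \<in> S" for s
  proof (rule ccontr)
    assume "\<not> s \<le> B"
    then have "\<not> s \<le> r m" for m
      using bound[of m] by linarith
    then have "{m. s \<le> r m} = {}"
      by auto
    then show False
      using that ultra_finite[of "{}"] by (simp add: S_def)
  qed
  then have bdd: "bdd_above S"
    by (auto simp: bdd_above_def)
  have "- B \<le> r m" for m
    using bound[of m] by linarith
  then have "{m. - B \<le> r m} = UNIV"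
    by auto
  then have "- B \<in> S"
    using ultra_UNIV by (simp add: S_def)
  then have ne: "S \<noteq> {}"
    by blast
  have "\<omega> {m. \<bar>r m - Sup S\<bar> < \<epsilon>} = 1" if "\<epsilon> > 0" for \<epsilon>
  proof -
    obtain s where s: "s \<in> S" "Sup S - \<epsilon> < s"
      using less_cSup_iff[OF ne bdd, of "Sup S - \<epsilon>"] \<open>\<epsilon> > 0\<close> by fastforce
    have "Sup S + \<epsilon> / 2 \<notin> S"
      using cSup_upper[OF _ bdd, of "Sup S + \<epsilon> / 2"] that by auto
    then have "\<omega> (- {m. Sup S + \<epsilon> / 2 \<le> r m}) = 1"
      using ultra_01 by (auto simp: S_def ultra_Compl)
    with s have "\<omega> ({m. s \<le> r m} \<inter> - {m. Sup S + \<epsilon> / 2 \<le> r m}) = 1"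
      by (intro ultra_Int) (auto simp: S_def)
    then show ?thesis
      by (rule ultra_mono) (use s that in auto)
  qed
  then show ?thesis
    using ultra_lim_eqI[of r "Sup S"] by auto
qed

context
  fixes X :: "nat \<Rightarrow> 'x metric" and p :: "nat \<Rightarrow> 'x"
  assumes base: "\<And>m. p m \<in> mspace (X m)"
begin

lemma bounded_seqs_dist:
  assumes "x \<in> bounded_seqs X p" "y \<in> bounded_seqs X p"
  shows "\<exists>B. \<forall>m. \<bar>mdist (X m) (x m) (y m)\<bar> \<le> B"
proof -
  obtain a b where a: "\<And>m. mdist (X m) (x m) (p m) \<le> a" and b: "\<And>m. mdist (X m) (y m) (p m) \<le> b"
    using assms by (auto simp: bounded_seqs_def bdd_above_def)
  have "x m \<in> mspace (X m)" "y m \<in> mspace (X m)" for m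
    using assms by (auto simp: bounded_seqs_def)
  then have "mdist (X m) (x m) (y m) \<le> a + b" for m
    using mdist_triangle[of "x m" "X m" "p m" "y m"] mdist_commute[of "X m" "p m" "y m"]
      a[of m] b[of m] base[of m] by fastforce
  then show ?thesis
    by (intro exI[of _ "a + b"]) simp
qed

lemma ultra_dist_tendsto:
  assumes "x \<in> bounded_seqs X p" "y \<in> bounded_seqs X p"
  shows "((\<lambda>m. mdist (X m) (x m) (y m)) \<longlongrightarrow> ultra_lim \<omega> (\<lambda>m. mdist (X m) (x m) (y m)))
           (Abs_filter (\<lambda>P. \<omega> {m. P m} = 1))"
proof -
  obtain B where "\<And>m. \<bar>mdist (X m) (x m) (y m)\<bar> \<le> B"
    using bounded_seqs_dist[OF assms] by blast
  then show ?thesis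
    unfolding ultra_tendsto_iff by (rule ultra_lim_works)
qed

lemma ultra_dist_nonneg:
  assumes "x \<in> bounded_seqs X p" "y \<in> bounded_seqs X p"
  shows "0 \<le> ultra_lim \<omega> (\<lambda>m. mdist (X m) (x m) (y m))"
  by (rule tendsto_lowerbound[OF ultra_dist_tendsto[OF assms]]) (auto simp: ultra_not_bot)

lemma ultra_dist_triangle:
  assumes "x \<in> bounded_seqs X p" "y \<in> bounded_seqs X p" "z \<in> bounded_seqs X p"
  shows "ultra_lim \<omega> (\<lambda>m. mdist (X m) (x m) (z m))
           \<le> ultra_lim \<omega> (\<lambda>m. mdist (X m) (x m) (y m)) + ultra_lim \<omega> (\<lambda>m. mdist (X m) (y m) (z m))"
proof -
  have "mdist (X m) (x m) (z m) \<le> mdist (X m) (x m) (y m) + mdist (X m) (y m) (z m)" for m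
    using assms by (intro mdist_triangle) (auto simp: bounded_seqs_def)
  then show ?thesis
    using tendsto_le[OF ultra_not_bot tendsto_add ultra_dist_tendsto] assms ultra_dist_tendsto
    by (meson always_eventually)
qed

lemma ultra_dist_commute:
  "ultra_lim \<omega> (\<lambda>m. mdist (X m) (x m) (y m)) = ultra_lim \<omega> (\<lambda>m. mdist (X m) (y m) (x m))"
  by (simp add: mdist_commute)

lemma equiv_ultra_rel: "equiv (bounded_seqs X p) (ultra_rel \<omega> X p)"
proof (rule equivI)
  show "ultra_rel \<omega> X p \<subseteq> bounded_seqs X p \<times> bounded_seqs X p"
    by (auto simp: ultra_rel_def)
  have "ultra_lim \<omega> (\<lambda>m. 0) = 0"
    by (rule ultra_lim_eqI) (simp add: ultra_UNIV)
  moreover have "(\<lambda>m. mdist (X m) (x m) (x m)) = (\<lambda>m. 0)" if "x \<in> bounded_seqs X p" for x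
    using that by (auto simp: bounded_seqs_def)
  ultimately show "refl_on (bounded_seqs X p) (ultra_rel \<omega> X p)"
    by (auto simp: refl_on_def ultra_rel_def)
  show "sym (ultra_rel \<omega> X p)"
    by (auto simp: sym_def ultra_rel_def mdist_commute)
  show "trans (ultra_rel \<omega> X p)"
  proof (rule transI)
    fix x y z
    assume xy: "(x, y) \<in> ultra_rel \<omega> X p" and yz: "(y, z) \<in> ultra_rel \<omega> X p"
    then show "(x, z) \<in> ultra_rel \<omega> X p"
      using ultra_dist_triangle[of x y z] ultra_dist_nonneg[of x z] by (simp add: ultra_rel_def)
  qed
qed

lemma ultra_dist_cong:
  assumes "(x, x') \<in> ultra_rel \<omega> X p" "(y, y') \<in> ultra_rel \<omega> X p"
  shows "ultra_lim \<omega> (\<lambda>m. mdist (X m) (x m) (y m)) = ultra_lim \<omega> (\<lambda>m. mdist (X m) (x' m) (y' m))"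
proof -
  have le: "ultra_lim \<omega> (\<lambda>m. mdist (X m) (u m) (v m)) \<le> ultra_lim \<omega> (\<lambda>m. mdist (X m) (u' m) (v' m))"
    if "(u, u') \<in> ultra_rel \<omega> X p" "(v', v) \<in> ultra_rel \<omega> X p" for u u' v v'
    using that ultra_dist_triangle[of u u' v] ultra_dist_triangle[of u' v' v]
    by (auto simp: ultra_rel_def)
  show ?thesis
    using le assms equiv_ultra_rel by (meson antisym equivE symD)
qed

lemma ultra_dist_class:
  assumes "x \<in> bounded_seqs X p" "y \<in> bounded_seqs X p"
  shows "ultra_dist \<omega> X p (ultra_class \<omega> X p x) (ultra_class \<omega> X p y)
         = ultra_lim \<omega> (\<lambda>m. mdist (X m) (x m) (y m))"
proof -
  have "(\<lambda>(x, y). ultra_lim \<omega> (\<lambda>m. mdist (X m) (x m) (y m))) `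
           (ultra_class \<omega> X p x \<times> ultra_class \<omega> X p y)
        = {ultra_lim \<omega> (\<lambda>m. mdist (X m) (x m) (y m))}" (is "?f ` ?A = {?c}")
  proof
    show "?f ` ?A \<subseteq> {?c}"
      using ultra_dist_cong by (fastforce simp: ultra_class_def)
    have "(x, y) \<in> ?A"
      using assms equiv_class_self[OF equiv_ultra_rel] by (auto simp: ultra_class_def)
    then show "{?c} \<subseteq> ?f ` ?A"
      by force
  qed
  moreover have "ultra_class \<omega> X p u \<in> bounded_seqs X p // ultra_rel \<omega> X p"
    if "u \<in> bounded_seqs X p" for u
    using that by (simp add: ultra_class_def quotientI)
  ultimately show ?thesis
    using assms by (simp add: ultra_dist_def)
qed

lemma quotient_classE:
  assumes "A \<in> bounded_seqs X p // ultra_rel \<omega> X p"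
  obtains x where "x \<in> bounded_seqs X p" "A = ultra_class \<omega> X p x"
  using assms by (auto simp: ultra_class_def elim: quotientE)

lemma Metric_space_ultralimit:
  "Metric_space (bounded_seqs X p // ultra_rel \<omega> X p) (ultra_dist \<omega> X p)"
  (is "Metric_space ?Q ?d")
proof
  fix A B
  have "0 \<le> ?d A B \<and> ?d A B = ?d B A"
  proof (cases "A \<in> ?Q \<and> B \<in> ?Q")
    case True
    then obtain x y where "x \<in> bounded_seqs X p" "A = ultra_class \<omega> X p x"
      "y \<in> bounded_seqs X p" "B = ultra_class \<omega> X p y"
      by (meson quotient_classE)
    then show ?thesis
      by (metis ultra_dist_class ultra_dist_nonneg ultra_dist_commute)
  next
    case False
    then have "?d A B = 0" "?d B A = 0"
      unfolding ultra_dist_def by argo+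
    then show ?thesis by linarith
  qed
  then show "0 \<le> ?d A B" "?d A B = ?d B A"
    by blast+
next
  fix A B
  assume "A \<in> ?Q" "B \<in> ?Q"
  then obtain x y where "x \<in> bounded_seqs X p" "A = ultra_class \<omega> X p x"
    "y \<in> bounded_seqs X p" "B = ultra_class \<omega> X p y"
    by (meson quotient_classE)
  then show "?d A B = 0 \<longleftrightarrow> A = B"
    using eq_equiv_class_iff[OF equiv_ultra_rel, of x y]
    by (simp add: ultra_dist_class ultra_class_def[symmetric]) (simp add: ultra_rel_def)
next
  fix A B C
  assume "A \<in> ?Q" "B \<in> ?Q" "C \<in> ?Q"
  then obtain x y z where "x \<in> bounded_seqs X p" "A = ultra_class \<omega> X p x"
    "y \<in> bounded_seqs X p" "B = ultra_class \<omega> X p y"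
    "z \<in> bounded_seqs X p" "C = ultra_class \<omega> X p z"
    by (meson quotient_classE)
  then show "?d A C \<le> ?d A B + ?d B C"
    by (simp only: ultra_dist_class ultra_dist_triangle)
qed

lemma mspace_ultralimit:
  "mspace (ultralimit \<omega> X p) = bounded_seqs X p // ultra_rel \<omega> X p"
  unfolding ultralimit_def by (rule Metric_space.mspace_metric[OF Metric_space_ultralimit])

lemma mdist_ultralimit:
  assumes "x \<in> bounded_seqs X p" "y \<in> bounded_seqs X p"
  shows "mdist (ultralimit \<omega> X p) (ultra_class \<omega> X p x) (ultra_class \<omega> X p y)
         = ultra_lim \<omega> (\<lambda>m. mdist (X m) (x m) (y m))"
  unfolding ultralimit_def
  using Metric_space.mdist_metric[OF Metric_space_ultralimit] assms by (simp add: ultra_dist_class)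

end

end

end

theory Submission
  imports Defs
begin

text \<open>
  A point \<open>y\<close> of \<open>Y k\<close> enters only through the sequence of its images \<open>f k m y\<close>. By separability and
  equi-continuity, countably many of these sequences approximate all the others uniformly in \<open>m\<close>.
  For a countable family, the diagonal choice \<open>ultra_diagonal_subsequence\<close> yields a subsequence along
  which all mutual distances converge to their ultralimits, with prescribed speed and with indices in
  prescribed sets of measure 1.

  Along this subsequence, the spaces contain almost isometric copies of larger and larger pieces of
  one limit configuration, and \<open>asymptotically_isometric_common_space\<close> embeds them isometrically into
  a space of bounded functions in such a way that each approximating sequence converges. The
  embedding consists of McShane extensions of distance functions, which take the place of a gluing of
  the spaces along their common points. By uniform approximation the other sequences of images
  converge as well, and the distance of two limits is the ultralimit of the distances
  (\<open>ultralimit_common_space\<close>). Equi-continuity turns pointwise convergence into uniform convergence on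
  compact sets (\<open>equi_continuous_limit\<close>).

  Consequently, sending the limit of a sequence of images to its class in the ultralimit preserves
  distances. This map extends to the closure of the set of limits by \<open>isometry_extends_to_closure\<close>,
  because the ultralimit is complete (\<open>mcomplete_ultralimit\<close>).
\<close>

section \<open>Limits, closures and isometries in metric spaces\<close>

lemma limitin_mtopology_of:
  "limitin (mtopology_of M) x z F \<longleftrightarrow>
     z \<in> mspace M \<and> (\<forall>\<^sub>F n in F. x n \<in> mspace M) \<and> ((\<lambda>n. mdist M (x n) z) \<longlongrightarrow> 0) F"
  by (simp add: mtopology_of_def Metric_space.limitin_metric_dist_null[OF Metric_space_mspace_mdist])

lemma limitin_mtopology_of_unique:
  "limitin (mtopology_of M) x y F \<Longrightarrow> limitin (mtopology_of M) x z F \<Longrightarrow> F \<noteq> bot \<Longrightarrow> y = z"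
  by (metis Metric_space.limitin_metric_unique Metric_space_mspace_mdist mtopology_of_def)

lemma in_closure_of_mtopology_of:
  "z \<in> mtopology_of M closure_of S \<longleftrightarrow>
     z \<in> mspace M \<and> (\<forall>e>0. \<exists>y\<in>S. y \<in> mspace M \<and> mdist M z y < e)"
  by (auto simp: mtopology_of_def Metric_space.metric_closure_of[OF Metric_space_mspace_mdist]
      Metric_space.in_mball[OF Metric_space_mspace_mdist])

lemma mdist_self [simp]: "x \<in> mspace M \<Longrightarrow> mdist M x x = 0"
  by simp

lemma abs_mdist_diff_le:
  assumes "x \<in> mspace M" "y \<in> mspace M" "x' \<in> mspace M" "y' \<in> mspace M"
  shows "\<bar>mdist M x y - mdist M x' y'\<bar> \<le> mdist M x x' + mdist M y y'"
  using mdist_triangle[of x M x' y] mdist_triangle[of x' M y' y]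
    mdist_triangle[of x' M x y'] mdist_triangle[of x M y y'] assms
  by (simp add: mdist_commute)

lemma tendsto_mdist:
  assumes x: "limitin (mtopology_of M) x a F" and y: "limitin (mtopology_of M) y b F"
  shows "((\<lambda>n. mdist M (x n) (y n)) \<longlongrightarrow> mdist M a b) F"
proof -
  have lim: "((\<lambda>n. mdist M (x n) a + mdist M (y n) b) \<longlongrightarrow> 0) F"
    using x y by (intro tendsto_add_zero) (auto simp: limitin_mtopology_of)
  have ab: "a \<in> mspace M" "b \<in> mspace M"
    and ev: "\<forall>\<^sub>F n in F. x n \<in> mspace M" "\<forall>\<^sub>F n in F. y n \<in> mspace M"
    using x y by (auto simp: limitin_mtopology_of)
  have "\<forall>\<^sub>F n in F. norm (mdist M (x n) (y n) - mdist M a b) \<le> mdist M (x n) a + mdist M (y n) b"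
    using ev by eventually_elim (simp add: abs_mdist_diff_le ab)
  then have "((\<lambda>n. mdist M (x n) (y n) - mdist M a b) \<longlongrightarrow> 0) F"
    by (rule Lim_null_comparison[OF _ lim])
  then show ?thesis
    by (simp add: LIM_zero_iff)
qed

lemma mcomplete_ofE:
  assumes "mcomplete_of M" "\<And>n. x n \<in> mspace M"
    and "\<And>e. e > 0 \<Longrightarrow> \<exists>N. \<forall>n\<ge>N. \<forall>n'\<ge>N. mdist M (x n) (x n') < e"
  obtains z where "limitin (mtopology_of M) x z sequentially"
proof -
  have "Metric_space.MCauchy (mspace M) (mdist M) x"
    using assms(2,3) by (fastforce simp: Metric_space.MCauchy_def[OF Metric_space_mspace_mdist])
  then show ?thesis
    using assms(1) that
    by (auto simp: mcomplete_of_def mtopology_of_def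
        Metric_space.mcomplete_def[OF Metric_space_mspace_mdist])
qed

lemma mcomplete_ofI:
  assumes "\<And>x :: nat \<Rightarrow> 'a. (\<And>n. x n \<in> mspace M) \<Longrightarrow>
      (\<And>e. e > 0 \<Longrightarrow> \<exists>N. \<forall>n\<ge>N. \<forall>n'\<ge>N. mdist M (x n) (x n') < e) \<Longrightarrow>
      \<exists>z. limitin (mtopology_of M) x z sequentially"
  shows "mcomplete_of M"
  unfolding mcomplete_of_def Metric_space.mcomplete_def[OF Metric_space_mspace_mdist]
    Metric_space.MCauchy_def[OF Metric_space_mspace_mdist]
proof (intro allI impI, elim conjE)
  fix x :: "nat \<Rightarrow> 'a" assume x: "range x \<subseteq> mspace M"
    and cauchy: "\<forall>e>0. \<exists>N. \<forall>n n'. N \<le> n \<longrightarrow> N \<le> n' \<longrightarrow> mdist M (x n) (x n') < e"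
  have "\<exists>z. limitin (mtopology_of M) x z sequentially"
  proof (rule assms)
    show "x n \<in> mspace M" for n
      using x by blast
    show "\<exists>N. \<forall>n\<ge>N. \<forall>n'\<ge>N. mdist M (x n) (x n') < e" if "e > 0" for e
      using cauchy that by meson
  qed
  then show "\<exists>z. limitin (Metric_space.mtopology (mspace M) (mdist M)) x z sequentially"
    unfolding mtopology_of_def .
qed

lemma tendsto_0_imp_Cauchy_sum:
  fixes b :: "nat \<Rightarrow> real"
  assumes "b \<longlonglongrightarrow> 0" "e > 0"
  shows "\<exists>N. \<forall>n\<ge>N. \<forall>n'\<ge>N. b n + b n' < e"
proof -
  have "\<forall>\<^sub>F n in sequentially. b n < e / 2"
    using assms by (intro order_tendstoD(2)) auto
  then obtain N where "\<And>n. n \<ge> N \<Longrightarrow> b n < e / 2"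
    by (auto simp: eventually_sequentially)
  then show ?thesis
    by (metis add_strict_mono field_sum_of_halves)
qed

text \<open>The map \<open>G t \<mapsto> H t\<close> is well defined because equality of points is vanishing of their distance,
  and it extends to limits because a sequence \<open>G (t n)\<close> that converges is Cauchy, hence so is
  \<open>H (t n)\<close>. Indexing both point sets by \<open>T\<close> spares the inverse of \<open>G\<close>, which need not be injective.\<close>

lemma isometry_extends_to_closure:
  assumes W: "mcomplete_of W"
    and G: "\<And>t. t \<in> T \<Longrightarrow> G t \<in> mspace Z" and H: "\<And>t. t \<in> T \<Longrightarrow> H t \<in> mspace W"
    and dist: "\<And>s t. s \<in> T \<Longrightarrow> t \<in> T \<Longrightarrow> mdist W (H s) (H t) = mdist Z (G s) (G t)"
  obtains \<eta> where "isometric_embedding (submetric Z (mtopology_of Z closure_of (G ` T))) W \<eta>"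
    and "\<And>t. t \<in> T \<Longrightarrow> \<eta> (G t) = H t"
proof -
  let ?C = "mtopology_of Z closure_of (G ` T)"
  let ?lim = "\<lambda>z w. \<exists>t. (\<forall>n. t n \<in> T) \<and> limitin (mtopology_of Z) (\<lambda>n. G (t n)) z sequentially
                       \<and> limitin (mtopology_of W) (\<lambda>n. H (t n)) w sequentially"
  have ex: "\<exists>w. ?lim z w" if z: "z \<in> ?C" for z
  proof -
    have "\<exists>t\<in>T. mdist Z z (G t) < 1 / Suc n" for n
      using z[unfolded in_closure_of_mtopology_of, THEN conjunct2, rule_format, of "1 / Suc n"] by auto
    then obtain t where t: "\<And>n. t n \<in> T" "\<And>n. mdist Z z (G (t n)) < 1 / Suc n"
      by metis
    have z': "z \<in> mspace Z"
      using z by (simp add: in_closure_of_mtopology_of)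
    have lim: "(\<lambda>n. mdist Z (G (t n)) z) \<longlonglongrightarrow> 0"
      by (rule tendsto_sandwich[OF _ _ tendsto_const LIMSEQ_Suc[OF lim_1_over_n]])
        (use t(2) in \<open>auto simp: mdist_commute less_imp_le\<close>)
    have "mdist W (H (t n)) (H (t n')) \<le> mdist Z (G (t n)) z + mdist Z (G (t n')) z" for n n'
      using mdist_triangle[of "G (t n)" Z z "G (t n')"] t(1) G z' by (simp add: dist mdist_commute)
    then have "\<exists>N. \<forall>n\<ge>N. \<forall>n'\<ge>N. mdist W (H (t n)) (H (t n')) < e" if "e > 0" for e
      using tendsto_0_imp_Cauchy_sum[OF lim that] by (meson le_less_trans)
    then obtain w where "limitin (mtopology_of W) (\<lambda>n. H (t n)) w sequentially"
      using mcomplete_ofE[OF W, of "\<lambda>n. H (t n)"] H t(1) by metis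
    then show ?thesis
      using t(1) lim G z' by (auto simp: limitin_mtopology_of intro!: exI[of _ w] exI[of _ t])
  qed
  define \<eta> where "\<eta> z = (SOME w. ?lim z w)" for z
  have \<eta>: "?lim z (\<eta> z)" if "z \<in> ?C" for z
    using someI_ex[OF ex[OF that]] by (simp add: \<eta>_def)
  have "isometric_embedding (submetric Z ?C) W \<eta>"
    unfolding isometric_embedding_def
  proof (intro conjI ballI Pi_I)
    show "\<eta> z \<in> mspace W" if "z \<in> mspace (submetric Z ?C)" for z
      using \<eta>[of z] that by (auto simp: limitin_mtopology_of)
    fix z z' assume "z \<in> mspace (submetric Z ?C)" "z' \<in> mspace (submetric Z ?C)"
    then have "?lim z (\<eta> z)" "?lim z' (\<eta> z')"
      using \<eta> by auto
    then obtain t t' where t: "\<And>n. t n \<in> T" "limitin (mtopology_of Z) (\<lambda>n. G (t n)) z sequentially"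
        "limitin (mtopology_of W) (\<lambda>n. H (t n)) (\<eta> z) sequentially"
      and t': "\<And>n. t' n \<in> T" "limitin (mtopology_of Z) (\<lambda>n. G (t' n)) z' sequentially"
        "limitin (mtopology_of W) (\<lambda>n. H (t' n)) (\<eta> z') sequentially"
      by blast
    have "(\<lambda>n. mdist Z (G (t n)) (G (t' n))) \<longlonglongrightarrow> mdist W (\<eta> z) (\<eta> z')"
      using tendsto_mdist[OF t(3) t'(3)] t(1) t'(1) by (simp add: dist)
    then show "mdist W (\<eta> z) (\<eta> z') = mdist (submetric Z ?C) z z'"
      using tendsto_mdist[OF t(2) t'(2)] by (simp add: LIMSEQ_unique)
  qed
  moreover have "\<eta> (G t) = H t" if t: "t \<in> T" for t
  proof -
    have "G t \<in> ?C"
      using t G by (intro subsetD[OF closure_of_subset]) auto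
    then obtain u where u: "\<And>n. u n \<in> T" "limitin (mtopology_of Z) (\<lambda>n. G (u n)) (G t) sequentially"
        "limitin (mtopology_of W) (\<lambda>n. H (u n)) (\<eta> (G t)) sequentially"
      using \<eta> by blast
    have "limitin (mtopology_of W) (\<lambda>n. H (u n)) (H t) sequentially"
      using u(1,2) t H by (simp add: limitin_mtopology_of dist)
    then show ?thesis
      using u(3) by (metis limitin_mtopology_of_unique trivial_limit_sequentially)
  qed
  ultimately show ?thesis
    using that by blast
qed

text \<open>A modulus of continuity common to all \<open>h l\<close> passes to the pointwise limit; on a compact set it
  reduces the estimate to the finitely many points of a \<open>\<delta>\<close>-net.\<close>

lemma equi_continuous_limit:
  assumes eq: "equi_continuous Y (\<lambda>_. Z) h"
    and h: "\<And>l y. y \<in> mspace Y \<Longrightarrow> h l y \<in> mspace Z"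
    and lim: "converges_pointwise Y Z h g"
  shows "continuous_map (mtopology_of Y) (mtopology_of Z) g"
    and "converges_uniformly_on_compacts Y Z h g"
proof -
  have limg: "limitin (mtopology_of Z) (\<lambda>l. h l y) (g y) sequentially" if "y \<in> mspace Y" for y
    using lim that by (simp add: converges_pointwise_def)
  then have g: "g y \<in> mspace Z" if "y \<in> mspace Y" for y
    using that by (auto simp: limitin_mtopology_of)
  have modulus: "\<exists>\<delta>>0. \<forall>x\<in>mspace Y. \<forall>y\<in>mspace Y. mdist Y x y < \<delta> \<longrightarrow>
      mdist Z (g x) (g y) \<le> e \<and> (\<forall>l. mdist Z (h l x) (h l y) < e)" if e: "e > 0" for e
  proof -
    obtain \<delta> where \<delta>: "\<delta> > 0" "\<And>x y l. x \<in> mspace Y \<Longrightarrow> y \<in> mspace Y \<Longrightarrow> mdist Y x y < \<delta>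
        \<Longrightarrow> mdist Z (h l x) (h l y) < e"
      using eq e by (metis equi_continuous_def)
    have "mdist Z (g x) (g y) \<le> e" if "x \<in> mspace Y" "y \<in> mspace Y" "mdist Y x y < \<delta>" for x y
      using that \<delta>(2) tendsto_mdist[OF limg limg, of x y]
      by (intro tendsto_upperbound[of "\<lambda>l. mdist Z (h l x) (h l y)" _ sequentially])
        (auto simp: less_imp_le)
    then show ?thesis
      using \<delta> by blast
  qed
  have "uniformly_continuous_map Y Z g"
    unfolding uniformly_continuous_map_def
  proof (intro conjI allI impI)
    show "g \<in> mspace Y \<rightarrow> mspace Z"
      using g by blast
    fix e :: real assume "e > 0"
    then obtain \<delta> where "\<delta> > 0" "\<forall>x\<in>mspace Y. \<forall>y\<in>mspace Y. mdist Y x y < \<delta> \<longrightarrow> mdist Z (g x) (g y) \<le> e / 2"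
      using modulus[of "e / 2"] by fastforce
    then show "\<exists>\<delta>>0. \<forall>x\<in>mspace Y. \<forall>y\<in>mspace Y. mdist Y y x < \<delta> \<longrightarrow> mdist Z (g y) (g x) < e"
      using \<open>e > 0\<close> by (intro exI[of _ \<delta>]) fastforce
  qed
  then show "continuous_map (mtopology_of Y) (mtopology_of Z) g"
    by (rule uniformly_continuous_imp_continuous_map)
  show "converges_uniformly_on_compacts Y Z h g"
    unfolding converges_uniformly_on_compacts_def
  proof (intro allI impI)
    fix K and e :: real
    assume K: "compactin (mtopology_of Y) K" and e: "e > 0"
    obtain \<delta> where \<delta>: "\<delta> > 0" "\<And>x y. x \<in> mspace Y \<Longrightarrow> y \<in> mspace Y \<Longrightarrow> mdist Y x y < \<delta> \<Longrightarrow>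
        mdist Z (g x) (g y) \<le> e / 3 \<and> (\<forall>l. mdist Z (h l x) (h l y) < e / 3)"
      using modulus[of "e / 3"] e by auto
    have KY: "K \<subseteq> mspace Y"
      using compactin_subset_topspace[OF K] by simp
    have "Metric_space.mtotally_bounded (mspace Y) (mdist Y) K"
      by (rule Metric_space.compactin_imp_mtotally_bounded[OF Metric_space_mspace_mdist
            K[unfolded mtopology_of_def]])
    then obtain A where A: "finite A" "A \<subseteq> K" "K \<subseteq> (\<Union>x\<in>A. Metric_space.mball (mspace Y) (mdist Y) x \<delta>)"
      using \<delta>(1) unfolding Metric_space.mtotally_bounded_def[OF Metric_space_mspace_mdist] by meson
    have "\<forall>\<^sub>F l in sequentially. \<forall>x\<in>A. mdist Z (h l x) (g x) < e / 3"
      using A limg KY e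
      by (intro eventually_ball_finite ballI order_tendstoD(2)[where y = 0])
        (auto simp: limitin_mtopology_of subset_iff)
    then show "\<forall>\<^sub>F l in sequentially. \<forall>y\<in>K. mdist Z (h l y) (g y) < e"
    proof eventually_elim
      case (elim l)
      show ?case
      proof
        fix y assume y: "y \<in> K"
        then obtain x where x: "x \<in> A" "mdist Y x y < \<delta>"
          using A(3) by (auto simp: Metric_space.in_mball[OF Metric_space_mspace_mdist])
        have in_Y: "x \<in> mspace Y" "y \<in> mspace Y"
          using x y A KY by auto
        have "mdist Z (h l y) (g y) \<le> mdist Z (h l y) (h l x) + mdist Z (h l x) (g x) + mdist Z (g x) (g y)"
          using mdist_triangle[of "h l y" Z "h l x" "g y"] mdist_triangle[of "h l x" Z "g x" "g y"] h g in_Y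
          by force
        moreover have "mdist Z (h l y) (h l x) < e / 3" "mdist Z (g x) (g y) \<le> e / 3"
          using \<delta>(2)[OF in_Y x(2)] by (simp_all add: mdist_commute)
        moreover have "mdist Z (h l x) (g x) < e / 3"
          using elim x(1) by blast
        ultimately show "mdist Z (h l y) (g y) < e"
          by linarith
      qed
    qed
  qed
qed

section \<open>Ultralimits\<close>

abbreviation ultra_filter :: "(nat set \<Rightarrow> real) \<Rightarrow> nat filter" where
  "ultra_filter \<omega> \<equiv> Abs_filter (\<lambda>P. \<omega> {m. P m} = 1)"

text \<open>Sets of measure 1 are infinite, so the indices can be picked one after another. Requirements
  that hold almost surely one at a time can thus all be met along a single subsequence.\<close>

lemma ultra_diagonal_subsequence:
  assumes \<omega>: "nonprincipal_ultrafilter \<omega>" and S: "\<And>l. \<omega> (S l) = 1"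
  obtains r :: "nat \<Rightarrow> nat" where "strict_mono r" "\<And>l. r l \<in> S l"
proof -
  have inf: "infinite (S l)" for l
    using ultra_finite[OF \<omega>, of "S l"] S[of l] by auto
  have "\<exists>r. \<forall>l. r l \<in> S l \<and> r l < r (Suc l)"
  proof (rule dependent_nat_choice)
    show "\<exists>m. m \<in> S 0"
      using inf[of 0] by (metis finite.emptyI ex_in_conv)
    show "\<exists>m. m \<in> S (Suc l) \<and> n < m" for n l
      using inf[of "Suc l"] unfolding infinite_nat_iff_unbounded by blast
  qed
  then show ?thesis
    using that by (auto simp: strict_mono_Suc_iff)
qed

lemma eventually_ge_ultra_filter:
  assumes \<omega>: "nonprincipal_ultrafilter \<omega>"
  shows "\<forall>\<^sub>F m in ultra_filter \<omega>. N \<le> m"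
proof -
  have "\<omega> {..<N} = 0"
    using \<omega> by (rule ultra_finite) simp
  then have "\<omega> (- {..<N}) = 1"
    by (simp only: ultra_Compl[OF \<omega>] diff_zero)
  moreover have "- {..<N} = {m. N \<le> m}"
    by auto
  ultimately have "\<omega> {m. N \<le> m} = 1"
    by metis
  then show ?thesis
    by (simp only: ultra_eventually[OF \<omega>])
qed

lemma bounded_seqs_memD: "x \<in> bounded_seqs X p \<Longrightarrow> x m \<in> mspace (X m)"
  by (simp add: bounded_seqs_def)

text \<open>A Cauchy sequence of classes has a limit because \<open>\<omega>\<close> is non-principal. For a fixed \<open>n\<close>, almost
  every \<open>X m\<close> realises the distances between the classes of index at most \<open>n\<close> up to \<open>1 / Suc n\<close>. In
  the coordinate \<open>m\<close> the limit follows the representative whose index \<open>N m\<close> is as large as this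
  allows; \<open>N m\<close> tends to infinity along \<open>\<omega>\<close>.\<close>

lemma mcomplete_ultralimit:
  fixes X :: "nat \<Rightarrow> 'x metric"
  assumes \<omega>: "nonprincipal_ultrafilter \<omega>" and p: "\<And>m. p m \<in> mspace (X m)"
  shows "mcomplete_of (ultralimit \<omega> X p)"
proof (rule mcomplete_ofI)
  let ?U = "ultralimit \<omega> X p" and ?cl = "ultra_class \<omega> X p"
  fix A :: "nat \<Rightarrow> (nat \<Rightarrow> 'x) set"
  assume A: "\<And>n. A n \<in> mspace ?U"
    and cauchy: "\<And>e. e > 0 \<Longrightarrow> \<exists>N. \<forall>n\<ge>N. \<forall>n'\<ge>N. mdist ?U (A n) (A n') < e"
  have "\<exists>x. x \<in> bounded_seqs X p \<and> A n = ?cl x" for n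
    using A[of n] unfolding mspace_ultralimit[OF \<omega> p] by (rule quotient_classE[OF \<omega> p]) blast
  then obtain x where x: "\<And>n. x n \<in> bounded_seqs X p" and A_eq: "\<And>n. A n = ?cl (x n)"
    by metis
  have xX: "x n m \<in> mspace (X m)" for n m
    using x by (rule bounded_seqs_memD)
  define c where "c i j = mdist ?U (A i) (A j)" for i j
  have c_lim: "((\<lambda>m. mdist (X m) (x i m) (x j m)) \<longlongrightarrow> c i j) (ultra_filter \<omega>)" for i j
    using ultra_dist_tendsto[OF \<omega> p x x] by (simp add: c_def A_eq mdist_ultralimit[OF \<omega> p] x)
  \<comment> \<open>The bound \<open>N \<le> m\<close> guarantees that there is a greatest good \<open>N\<close>.\<close>
  define good where "good m N \<longleftrightarrow> N \<le> m \<and>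
      (\<forall>i\<in>{..N}. \<forall>j\<in>{..N}. mdist (X m) (x i m) (x j m) < c i j + 1 / Suc N)" for m N
  define N where "N m = (GREATEST N. good m N)" for m
  have good_0: "good m 0" for m
    using xX[of 0 m] A[of 0] by (simp add: good_def c_def)
  have good_le: "n \<le> m" if "good m n" for m n
    using that by (simp add: good_def)
  have good_N: "good m (N m)" for m
    unfolding N_def using good_0 good_le by (rule GreatestI_nat)
  have le_N: "n \<le> N m" if "good m n" for m n
    unfolding N_def using that good_le by (rule Greatest_le_nat)
  define y where "y m = x (N m) m" for m
  have y_dist: "mdist (X m) (y m) (x n m) < c (N m) n + 1 / Suc (N m)" if "n \<le> N m" for m n
    using good_N[of m] that by (simp add: good_def y_def)
  obtain B where B: "\<And>j. c j 0 \<le> B"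
  proof -
    obtain M where M: "\<And>j. j \<ge> M \<Longrightarrow> c j M < 1"
      using cauchy[of 1] by (auto simp: c_def)
    have "c j 0 \<le> Max ((\<lambda>j. c j 0) ` {..M}) + 1" for j
    proof (cases "j \<le> M")
      case True
      then have "c j 0 \<le> Max ((\<lambda>j. c j 0) ` {..M})"
        by (intro Max_ge) auto
      then show ?thesis by simp
    next
      case False
      have "c j 0 \<le> c j M + c M 0"
        unfolding c_def by (intro mdist_triangle A)
      moreover have "c M 0 \<le> Max ((\<lambda>j. c j 0) ` {..M})"
        by (intro Max_ge) auto
      moreover have "c j M < 1"
        using M[of j] False by simp
      ultimately show ?thesis
        by linarith
    qed
    then show ?thesis
      using that by blast
  qed
  have y: "y \<in> bounded_seqs X p"
  proof -
    obtain b where b: "\<And>m. mdist (X m) (x 0 m) (p m) \<le> b"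
      using x[of 0] by (auto simp: bounded_seqs_def bdd_above_def)
    have "mdist (X m) (y m) (p m) \<le> B + 1 + b" for m
    proof -
      have "mdist (X m) (y m) (p m) \<le> mdist (X m) (y m) (x 0 m) + mdist (X m) (x 0 m) (p m)"
        by (intro mdist_triangle) (auto simp: y_def xX p)
      moreover have "1 / real (Suc (N m)) \<le> 1"
        by simp
      ultimately show ?thesis
        using y_dist[of 0 m] B[of "N m"] b[of m] by linarith
    qed
    then show ?thesis
      by (auto simp: bounded_seqs_def bdd_above_def y_def xX)
  qed
  have ev_good: "\<forall>\<^sub>F m in ultra_filter \<omega>. good m n" for n
    unfolding good_def
  proof (intro eventually_conj eventually_ge_ultra_filter[OF \<omega>] eventually_ball_finite finite_atMost ballI)
    show "\<forall>\<^sub>F m in ultra_filter \<omega>. mdist (X m) (x i m) (x j m) < c i j + 1 / real (Suc n)" for i j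
      using c_lim by (rule order_tendstoD) simp
  qed
  have "(\<lambda>n. mdist ?U (A n) (?cl y)) \<longlonglongrightarrow> 0"
  proof (rule LIMSEQ_I)
    fix e :: real assume e: "e > 0"
    obtain n0 where n0: "\<And>i j. n0 \<le> i \<Longrightarrow> n0 \<le> j \<Longrightarrow> c i j < e / 4"
      using cauchy[of "e / 4"] e by (auto simp: c_def)
    obtain n1 where n1: "1 / real (Suc n1) < e / 4"
      using nat_approx_posE[of "e / 4"] e by auto
    have "norm (mdist ?U (A n) (?cl y) - 0) < e" if n: "n \<ge> n0" for n
    proof -
      have "\<forall>\<^sub>F m in ultra_filter \<omega>. mdist (X m) (x n m) (y m) \<le> e / 2"
        using ev_good[of "max n n1"]
      proof eventually_elim
        case (elim m)
        then have le: "max n n1 \<le> N m"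
          by (rule le_N)
        have "1 / real (Suc (N m)) \<le> 1 / real (Suc n1)"
          using le by (intro divide_left_mono) auto
        moreover have "c (N m) n < e / 4"
          using n0[of "N m" n] le n by simp
        ultimately show ?case
          using y_dist[of n m] le n1 by (simp add: mdist_commute)
      qed
      then have "mdist ?U (A n) (?cl y) \<le> e / 2"
        unfolding A_eq mdist_ultralimit[OF \<omega> p x y]
        by (rule tendsto_upperbound[OF ultra_dist_tendsto[OF \<omega> p x y] _ ultra_not_bot[OF \<omega>]])
      then show ?thesis
        using e by simp
    qed
    then show "\<exists>no. \<forall>n\<ge>no. norm (mdist ?U (A n) (?cl y) - 0) < e"
      by blast
  qed
  moreover have "?cl y \<in> mspace ?U"
    using y by (simp add: mspace_ultralimit[OF \<omega> p] ultra_class_def quotientI)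
  ultimately show "\<exists>z. limitin (mtopology_of ?U) A z sequentially"
    using A by (auto simp: limitin_mtopology_of)
qed

section \<open>The supremum metric\<close>

text \<open>The distance is 0 off the carrier, since a metric has to be nonnegative for arbitrary arguments and
  the supremum of an unbounded set is an unspecified real number.\<close>

definition sup_metric :: "('s \<Rightarrow> real) metric" where
  "sup_metric = metric ({h. bounded (range h)},
     \<lambda>h k. if bounded (range h) \<and> bounded (range k) then SUP s. \<bar>h s - k s\<bar> else 0)"

lemma bdd_above_abs_diff:
  fixes h k :: "'s \<Rightarrow> real"
  assumes "bounded (range h)" "bounded (range k)"
  shows "bdd_above (range (\<lambda>s. \<bar>h s - k s\<bar>))"
proof -
  obtain a b where ab: "\<And>s. \<bar>h s\<bar> \<le> a" "\<And>s. \<bar>k s\<bar> \<le> b"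
    using assms by (auto simp: bounded_iff)
  then have "\<bar>h s - k s\<bar> \<le> a + b" for s
    using ab[of s] by linarith
  then show ?thesis
    by (auto simp: bdd_above_def)
qed

lemma Metric_space_sup_metric:
  "Metric_space {h :: 's \<Rightarrow> real. bounded (range h)}
     (\<lambda>h k. if bounded (range h) \<and> bounded (range k) then SUP s. \<bar>h s - k s\<bar> else 0)"
proof (unfold_locales, goal_cases)
  case (1 h k)
  have "0 \<le> (SUP s. \<bar>h s - k s\<bar>)" if "bounded (range h)" "bounded (range k)"
    by (rule cSUP_upper2[OF bdd_above_abs_diff[OF that] UNIV_I]) simp
  then show ?case
    by simp
next
  case (2 h k)
  show ?case
    by (auto simp: abs_minus_commute)
next
  case (3 h k)
  then have b: "bdd_above (range (\<lambda>s. \<bar>h s - k s\<bar>))"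
    by (auto intro: bdd_above_abs_diff)
  show ?case
  proof
    assume "(if bounded (range h) \<and> bounded (range k) then SUP s. \<bar>h s - k s\<bar> else 0) = 0"
    then have "\<bar>h s - k s\<bar> \<le> 0" for s
      using cSUP_upper[OF _ b, of s] 3 by simp
    then show "h = k"
      by auto
  qed auto
next
  case (4 h k j)
  have le: "\<bar>f s - g s\<bar> \<le> (SUP s. \<bar>f s - g s\<bar>)"
    if "bounded (range f)" "bounded (range g)" for f g :: "'s \<Rightarrow> real" and s
    by (rule cSUP_upper[OF UNIV_I bdd_above_abs_diff[OF that]])
  have "\<bar>h s - j s\<bar> \<le> (SUP s. \<bar>h s - k s\<bar>) + (SUP s. \<bar>k s - j s\<bar>)" for s
    using le[of h k s] le[of k j s] 4 by simp
  then have "(SUP s. \<bar>h s - j s\<bar>) \<le> (SUP s. \<bar>h s - k s\<bar>) + (SUP s. \<bar>k s - j s\<bar>)"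
    by (rule cSUP_least[OF UNIV_not_empty])
  then show ?case
    using 4 by simp
qed

lemma mspace_sup_metric: "mspace sup_metric = {h. bounded (range h)}"
  unfolding sup_metric_def by (rule Metric_space.mspace_metric[OF Metric_space_sup_metric])

lemma mdist_sup_metric:
  assumes "bounded (range h)" "bounded (range k)"
  shows "mdist sup_metric h k = (SUP s. \<bar>h s - k s\<bar>)"
  unfolding sup_metric_def Metric_space.mdist_metric[OF Metric_space_sup_metric] using assms by simp

lemma mdist_sup_metric_le:
  assumes "bounded (range h)" "bounded (range k)" "\<And>s. \<bar>h s - k s\<bar> \<le> e"
  shows "mdist sup_metric h k \<le> e"
  unfolding mdist_sup_metric[OF assms(1,2)] by (rule cSUP_least[OF UNIV_not_empty assms(3)])

lemma abs_diff_le_mdist_sup_metric: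
  assumes "bounded (range h)" "bounded (range k)"
  shows "\<bar>h s - k s\<bar> \<le> mdist sup_metric h k"
  unfolding mdist_sup_metric[OF assms] by (rule cSUP_upper[OF UNIV_I bdd_above_abs_diff[OF assms]])

lemma mcomplete_sup_metric: "mcomplete_of (sup_metric :: ('s \<Rightarrow> real) metric)"
proof (rule mcomplete_ofI)
  fix h :: "nat \<Rightarrow> 's \<Rightarrow> real"
  assume h: "\<And>n. h n \<in> mspace sup_metric"
    and cauchy: "\<And>e. e > 0 \<Longrightarrow> \<exists>N. \<forall>n\<ge>N. \<forall>n'\<ge>N. mdist sup_metric (h n) (h n') < e"
  have bd: "bounded (range (h n))" for n
    using h by (auto simp: mspace_sup_metric)
  have "uniformly_Cauchy_on UNIV h"
    unfolding uniformly_Cauchy_on_def dist_real_def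
    using cauchy abs_diff_le_mdist_sup_metric[OF bd bd] by (meson le_less_trans)
  then obtain g where "uniform_limit UNIV h g sequentially"
    using uniformly_convergent_on_def[of UNIV h] Cauchy_uniformly_convergent by blast
  then have g: "\<forall>\<^sub>F n in sequentially. \<forall>s. \<bar>h n s - g s\<bar> < e" if "e > 0" for e
    using that by (auto simp: uniform_limit_iff dist_real_def)
  obtain n where n: "\<And>s. \<bar>h n s - g s\<bar> < 1"
    using g[of 1] by (auto simp: eventually_sequentially)
  obtain b where b: "\<And>s. \<bar>h n s\<bar> \<le> b"
    using bd[of n] by (auto simp: bounded_iff)
  have "\<bar>g s\<bar> \<le> b + 1" for s
    using n[of s] b[of s] by linarith
  then have bg: "bounded (range g)"
    by (auto simp: bounded_iff)
  have "(\<lambda>n. mdist sup_metric (h n) g) \<longlonglongrightarrow> 0"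
  proof (rule tendstoI)
    fix e :: real assume "e > 0"
    then have "\<forall>\<^sub>F n in sequentially. \<forall>s. \<bar>h n s - g s\<bar> < e / 2"
      using g[of "e / 2"] by simp
    then show "\<forall>\<^sub>F n in sequentially. dist (mdist sup_metric (h n) g) 0 < e"
    proof eventually_elim
      case (elim n)
      then have "mdist sup_metric (h n) g \<le> e / 2"
        by (intro mdist_sup_metric_le bd bg) (auto simp: less_imp_le)
      then show ?case
        using \<open>e > 0\<close> by simp
    qed
  qed
  then show "\<exists>g. limitin (mtopology_of sup_metric) h g sequentially"
    using bd bg by (auto simp: limitin_mtopology_of mspace_sup_metric)
qed

section \<open>A common space for asymptotically isometric configurations\<close>

lemma abs_diff_Min_le:
  fixes f g :: "'a \<Rightarrow> real"
  assumes "finite A" "A \<noteq> {}" "\<And>j. j \<in> A \<Longrightarrow> \<bar>f j - g j\<bar> \<le> e"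
  shows "\<bar>Min (f ` A) - Min (g ` A)\<bar> \<le> e"
proof -
  have "Min (f ` A) \<le> Min (g ` A) + e" if "\<And>j. j \<in> A \<Longrightarrow> f j \<le> g j + e" for f g :: "'a \<Rightarrow> real"
  proof -
    obtain j where j: "j \<in> A" "Min (g ` A) = g j"
      using Min_in[of "g ` A"] assms(1,2) by blast
    then have "Min (f ` A) \<le> f j"
      using assms(1) by simp
    then show ?thesis
      using that[OF j(1)] j(2) by simp
  qed
  from this[of f g] this[of g f] show ?thesis
    using assms(3) by (force simp: abs_le_iff)
qed

text \<open>The points \<open>a 0 l, \<dots>, a l l\<close> form an almost isometric copy of an initial piece of one pseudometric
  \<open>D\<close> on the natural numbers. An isometric embedding of \<open>X l\<close> into a space of bounded functions amounts
  to a family of 1-Lipschitz functions on \<open>X l\<close> that together recover the distance. There is one for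
  each pair \<open>s = (k, x)\<close> with \<open>x\<close> in \<open>X k\<close>, and on \<open>X k\<close> itself it is the distance to \<open>x\<close>.

  This function is carried over to the natural numbers by McShane's formula, as the minimum \<open>v s i\<close> of
  \<open>mdist (X k) x (a j k) + D j i\<close> over \<open>j \<le> k\<close>, which is 1-Lipschitz for \<open>D\<close>; and from there to every
  other \<open>X l\<close> by the same formula, with the points \<open>a i l\<close> for \<open>i \<le> l\<close>. A distortion of at most
  \<open>\<epsilon> l\<close> in the distances costs at most \<open>\<epsilon> l\<close> in the values: at \<open>a i l\<close> the function \<open>u l\<close> is within
  \<open>\<epsilon> l\<close> of \<open>v s i\<close>, uniformly in \<open>s\<close>. Hence the images of the points \<open>a i l\<close> converge in the supremum
  metric, with limit \<open>v s i\<close> as a function of \<open>s\<close>.\<close>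

lemma asymptotically_isometric_common_space:
  fixes X :: "nat \<Rightarrow> 'x metric" and a :: "nat \<Rightarrow> nat \<Rightarrow> 'x" and D :: "nat \<Rightarrow> nat \<Rightarrow> real"
  assumes a: "\<And>i l. a i l \<in> mspace (X l)"
    and approx: "\<And>l i j. i \<le> l \<Longrightarrow> j \<le> l \<Longrightarrow> \<bar>mdist (X l) (a i l) (a j l) - D i j\<bar> \<le> \<epsilon> l"
    and \<epsilon>: "\<epsilon> \<longlonglongrightarrow> 0"
  obtains Z :: "'x common_point metric" and \<iota> c where "mcomplete_of Z"
    "\<And>l. isometric_embedding (X l) Z (\<iota> l)"
    "\<And>i. limitin (mtopology_of Z) (\<lambda>l. \<iota> l (a i l)) (c i) sequentially"
proof -
  have D_lim: "(\<lambda>l. mdist (X l) (a i l) (a j l)) \<longlonglongrightarrow> D i j" for i j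
  proof -
    have "\<forall>\<^sub>F l in sequentially. norm (mdist (X l) (a i l) (a j l) - D i j) \<le> \<epsilon> l"
      using eventually_ge_at_top[of "max i j"] by eventually_elim (simp add: approx)
    then show ?thesis
      by (rule LIM_zero_cancel[OF Lim_null_comparison[OF _ \<epsilon>]])
  qed
  have D_triangle: "D i k \<le> D i j + D j k" for i j k
    by (rule LIMSEQ_le[OF D_lim tendsto_add[OF D_lim D_lim]]) (use a in \<open>auto intro!: mdist_triangle\<close>)
  have D_commute: "D i j = D j i" for i j
    using LIMSEQ_unique[OF D_lim[of i j]] D_lim[of j i] by (simp add: mdist_commute)
  have D_refl: "D i i = 0" for i
  proof (rule LIMSEQ_unique[OF D_lim])
    show "(\<lambda>l. mdist (X l) (a i l) (a i l)) \<longlonglongrightarrow> 0"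
      using a by simp
  qed
  define v where "v = (\<lambda>(l, x) i. Min ((\<lambda>j. mdist (X l) x (a j l) + D j i) ` {..l}))"
  define u where "u l x s = (if l = fst s then mdist (X l) (snd s) x
      else Min ((\<lambda>i. v s i + mdist (X l) x (a i l)) ` {..l}))" for l x s
  \<comment> \<open>An index \<open>(k, x)\<close> with \<open>x\<close> outside \<open>X k\<close> says nothing; all functions will vanish there.\<close>
  define valid where "valid s \<longleftrightarrow> snd s \<in> mspace (X (fst s))" for s
  have v_lipschitz: "\<bar>v s i - v s j\<bar> \<le> D i j" for s i j
    unfolding v_def case_prod_beta
    using D_triangle[of _ i j] D_triangle[of _ j i] D_commute[of i j]
    by (intro abs_diff_Min_le) (auto simp: abs_le_iff algebra_simps)
  have u_lipschitz: "\<bar>u l x s - u l y s\<bar> \<le> mdist (X l) x y"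
    if "valid s" "x \<in> mspace (X l)" "y \<in> mspace (X l)" for l x y s
  proof (cases "l = fst s")
    case True
    then show ?thesis
      using abs_mdist_diff_le[of "snd s" "X l" x "snd s" y] that by (simp add: u_def valid_def)
  next
    case False
    have "\<bar>mdist (X l) x (a i l) - mdist (X l) y (a i l)\<bar> \<le> mdist (X l) x y" for i
      using abs_mdist_diff_le[of x "X l" "a i l" y "a i l"] that a by simp
    then show ?thesis
      using False unfolding u_def by (simp, intro abs_diff_Min_le) auto
  qed
  have u_near_v: "\<bar>u l (a i l) s - v s i\<bar> \<le> \<epsilon> l" if s: "valid s" and i: "i \<le> l" for l i s
  proof (cases "l = fst s")
    case True
    \<comment> \<open>Up to \<open>\<epsilon> l\<close>, the minimum defining \<open>v s i\<close> is attained at \<open>j = i\<close>, by the triangle inequality in \<open>X l\<close>.\<close>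
    let ?x = "snd s"
    have x: "?x \<in> mspace (X l)"
      using s True by (simp add: valid_def)
    have v: "v s i = Min ((\<lambda>j. mdist (X l) ?x (a j l) + D j i) ` {..l})"
      by (simp add: v_def case_prod_beta True)
    have "v s i \<le> mdist (X l) ?x (a i l)"
      unfolding v using i D_refl[of i] by (intro Min_le) (auto intro!: image_eqI[of _ _ i])
    moreover have "mdist (X l) ?x (a i l) - \<epsilon> l \<le> v s i"
      unfolding v
    proof (subst Min_ge_iff, simp, simp, intro ballI, elim imageE)
      fix t j assume "j \<in> {..l}" "t = mdist (X l) ?x (a j l) + D j i"
      then show "mdist (X l) ?x (a i l) - \<epsilon> l \<le> t"
        using mdist_triangle[OF x a[of j l] a[of i l]] approx[of j l i] i by auto
    qed
    ultimately show ?thesis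
      using True approx[of i l i] i by (simp add: u_def abs_le_iff)
  next
    case False
    \<comment> \<open>Here the minimum defining \<open>u\<close> is attained at \<open>j = i\<close> up to \<open>\<epsilon> l\<close>, as \<open>v s\<close> is 1-Lipschitz for \<open>D\<close>.\<close>
    have u: "u l (a i l) s = Min ((\<lambda>j. v s j + mdist (X l) (a i l) (a j l)) ` {..l})"
      by (simp add: u_def False)
    have "u l (a i l) s \<le> v s i"
      unfolding u using i a by (intro Min_le) (auto intro!: image_eqI[of _ _ i])
    moreover have "v s i - \<epsilon> l \<le> u l (a i l) s"
      unfolding u
    proof (subst Min_ge_iff, simp, simp, intro ballI, elim imageE)
      fix t j assume "j \<in> {..l}" "t = v s j + mdist (X l) (a i l) (a j l)"
      then show "v s i - \<epsilon> l \<le> t"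
        using v_lipschitz[of s i j] approx[of i l j] i by auto
    qed
    ultimately show ?thesis
      using approx[of i l i] i by (simp add: abs_le_iff)
  qed
  \<comment> \<open>Subtracting the limit \<open>v s 0\<close> of the points \<open>a 0 l\<close> makes these functions bounded in \<open>s\<close>.\<close>
  define \<iota> where "\<iota> l x s = (if valid s then u l x s - v s 0 else 0)" for l x s
  define c where "c i s = (if valid s then v s i - v s 0 else 0)" for i s
  have eps_nonneg: "0 \<le> \<epsilon> l" for l
    using approx[of 0 l 0] by simp
  have bounded_\<iota>: "bounded (range (\<iota> l x))" if x: "x \<in> mspace (X l)" for l x
  proof -
    have "\<bar>\<iota> l x s\<bar> \<le> mdist (X l) x (a 0 l) + \<epsilon> l" for s
      using u_lipschitz[OF _ x a[of 0 l], of s] u_near_v[of s 0 l] eps_nonneg[of l] by (auto simp: \<iota>_def)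
    then show ?thesis
      by (auto simp: bounded_iff)
  qed
  have bounded_c: "bounded (range (c i))" for i
  proof -
    have "\<bar>c i s\<bar> \<le> \<bar>D i 0\<bar>" for s
      using v_lipschitz[of s i 0] by (auto simp: c_def)
    then show ?thesis
      by (auto simp: bounded_iff)
  qed
  have "isometric_embedding (X l) sup_metric (\<iota> l)" for l
    unfolding isometric_embedding_def
  proof (intro conjI ballI Pi_I)
    show "\<iota> l x \<in> mspace sup_metric" if "x \<in> mspace (X l)" for x
      using bounded_\<iota>[OF that] by (simp add: mspace_sup_metric)
    fix x y assume x: "x \<in> mspace (X l)" and y: "y \<in> mspace (X l)"
    have "\<bar>\<iota> l x s - \<iota> l y s\<bar> \<le> mdist (X l) x y" for s
      using u_lipschitz[OF _ x y, of s] by (simp add: \<iota>_def)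
    then have "mdist sup_metric (\<iota> l x) (\<iota> l y) \<le> mdist (X l) x y"
      by (intro mdist_sup_metric_le bounded_\<iota> x y)
    \<comment> \<open>The supremum is attained at the function that measures the distance to \<open>y\<close> itself.\<close>
    moreover have "\<bar>\<iota> l x (l, y) - \<iota> l y (l, y)\<bar> = mdist (X l) x y"
      using y by (simp add: \<iota>_def u_def valid_def mdist_commute)
    then have "mdist (X l) x y \<le> mdist sup_metric (\<iota> l x) (\<iota> l y)"
      using abs_diff_le_mdist_sup_metric[OF bounded_\<iota>[OF x] bounded_\<iota>[OF y]] by metis
    ultimately show "mdist sup_metric (\<iota> l x) (\<iota> l y) = mdist (X l) x y"
      by linarith
  qed
  moreover have "limitin (mtopology_of sup_metric) (\<lambda>l. \<iota> l (a i l)) (c i) sequentially" for i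
  proof -
    have "\<forall>\<^sub>F l in sequentially. norm (mdist sup_metric (\<iota> l (a i l)) (c i)) \<le> \<epsilon> l"
      using eventually_ge_at_top[of i]
    proof eventually_elim
      case (elim l)
      have "\<bar>\<iota> l (a i l) s - c i s\<bar> \<le> \<epsilon> l" for s
        using u_near_v[OF _ elim, of s] eps_nonneg[of l] by (simp add: \<iota>_def c_def)
      then show ?case
        using mdist_sup_metric_le[OF bounded_\<iota>[OF a] bounded_c] by simp
    qed
    then have "(\<lambda>l. mdist sup_metric (\<iota> l (a i l)) (c i)) \<longlonglongrightarrow> 0"
      using \<epsilon> by (rule Lim_null_comparison)
    then show ?thesis
      using bounded_\<iota>[OF a] bounded_c by (simp add: limitin_mtopology_of mspace_sup_metric)
  qed
  ultimately show ?thesis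
    using that mcomplete_sup_metric by blast
qed

section \<open>Realising ultralimit distances along a subsequence\<close>

text \<open>A diagonal choice deals with the countable set \<open>D\<close>: along \<open>r\<close>, the distances between its first
  members are within \<open>1 / Suc l\<close> of their ultralimits. Since \<open>D\<close> is dense in \<open>S\<close> uniformly in \<open>m\<close>,
  convergence and the values of the limit distances pass from \<open>D\<close> to \<open>S\<close>. So the limits in \<open>Z\<close> remember
  the ultralimit of the distances even when the range of \<open>r\<close> is a null set of \<open>\<omega>\<close>.\<close>

lemma ultralimit_common_space:
  fixes X :: "nat \<Rightarrow> 'x metric"
  assumes \<omega>: "nonprincipal_ultrafilter \<omega>" and p: "\<And>m. p m \<in> mspace (X m)"
    and S: "S \<subseteq> bounded_seqs X p"
    and D: "countable D" "D \<subseteq> bounded_seqs X p"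
    and dense: "\<And>s e. s \<in> S \<Longrightarrow> e > 0 \<Longrightarrow> \<exists>a\<in>D. \<forall>m. mdist (X m) (s m) (a m) < e"
    and F: "\<And>l. \<omega> (F l) = 1"
  obtains Z :: "'x common_point metric" and r \<iota> c where
    "mcomplete_of Z" "strict_mono r" "\<And>l. r l \<in> F l"
    "\<And>l. isometric_embedding (X (r l)) Z (\<iota> l)"
    "\<And>s. s \<in> S \<Longrightarrow> limitin (mtopology_of Z) (\<lambda>l. \<iota> l (s (r l))) (c s) sequentially"
    "\<And>s t. s \<in> S \<Longrightarrow> t \<in> S \<Longrightarrow>
       mdist Z (c s) (c t) = ultra_lim \<omega> (\<lambda>m. mdist (X m) (s m) (t m))"
proof -
  let ?lim = "\<lambda>s t. ultra_lim \<omega> (\<lambda>m. mdist (X m) (s m) (t m))"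
  \<comment> \<open>The base point sequence is added so that there is something to enumerate when \<open>D\<close> is empty.\<close>
  define a where "a = from_nat_into (insert p D)"
  have "p \<in> bounded_seqs X p"
    using p by (auto simp: bounded_seqs_def)
  then have a: "a i \<in> bounded_seqs X p" for i
    using from_nat_into[of "insert p D" i] D(2) by (auto simp: a_def)
  have ex_a: "\<exists>i. \<forall>m. mdist (X m) (s m) (a i m) < e" if "s \<in> S" "e > 0" for s e
  proof -
    obtain b where b: "b \<in> D" "\<forall>m. mdist (X m) (s m) (b m) < e"
      using dense[OF \<open>s \<in> S\<close> \<open>e > 0\<close>] by blast
    obtain i where "a i = b"
      unfolding a_def using from_nat_into_surj[of "insert p D" b] D(1) b(1) by auto
    then show ?thesis
      using b(2) by blast
  qed
  have mem: "s m \<in> mspace (X m)" if "s \<in> S" for s m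
    using that S by (auto dest: bounded_seqs_memD)
  have a_mem: "a i m \<in> mspace (X m)" for i m
    using a by (rule bounded_seqs_memD)
  define G where "G l = {m. \<forall>i\<in>{..l}. \<forall>j\<in>{..l}.
      \<bar>mdist (X m) (a i m) (a j m) - ?lim (a i) (a j)\<bar> < 1 / Suc l}" for l
  have "\<omega> (G l) = 1" for l
    unfolding G_def
  proof (intro ultra_eventually[OF \<omega>, THEN iffD1] eventually_ball_finite finite_atMost ballI)
    show "\<forall>\<^sub>F m in ultra_filter \<omega>. \<bar>mdist (X m) (a i m) (a j m) - ?lim (a i) (a j)\<bar> < 1 / Suc l" for i j
      using tendstoD[OF ultra_dist_tendsto[OF \<omega> p a a], of "1 / Suc l" i j] by (simp add: dist_real_def)
  qed
  then have "\<omega> (F l \<inter> G l) = 1" for l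
    using ultra_Int[OF \<omega> F] by blast
  then obtain r where r: "strict_mono r" "\<And>l. r l \<in> F l \<inter> G l"
    using ultra_diagonal_subsequence[OF \<omega>, of "\<lambda>l. F l \<inter> G l"] by blast
  have approx: "\<bar>mdist (X (r l)) (a i (r l)) (a j (r l)) - ?lim (a i) (a j)\<bar> \<le> 1 / Suc l"
    if "i \<le> l" "j \<le> l" for i j l
    using r(2)[of l] that by (auto simp: G_def intro: less_imp_le)
  obtain Z :: "'x common_point metric" and \<iota> c0 where Z: "mcomplete_of Z"
    and iso: "\<And>l. isometric_embedding (X (r l)) Z (\<iota> l)"
    and c0: "\<And>i. limitin (mtopology_of Z) (\<lambda>l. \<iota> l (a i (r l))) (c0 i) sequentially"
    using asymptotically_isometric_common_space[of "\<lambda>i l. a i (r l)" "\<lambda>l. X (r l)",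
        OF a_mem approx LIMSEQ_Suc[OF lim_1_over_n]] by blast
  have \<iota>_mem: "\<iota> l x \<in> mspace Z" if "x \<in> mspace (X (r l))" for l x
    using iso[of l] that by (auto simp: isometric_embedding_def)
  have \<iota>_dist: "mdist Z (\<iota> l x) (\<iota> l y) = mdist (X (r l)) x y"
    if "x \<in> mspace (X (r l))" "y \<in> mspace (X (r l))" for l x y
    using iso[of l] that by (auto simp: isometric_embedding_def)
  have "\<exists>z. limitin (mtopology_of Z) (\<lambda>l. \<iota> l (s (r l))) z sequentially" if s: "s \<in> S" for s
  proof (rule mcomplete_ofE[OF Z])
    show "\<iota> l (s (r l)) \<in> mspace Z" for l
      by (intro \<iota>_mem mem s)
    fix e :: real assume e: "e > 0"
    obtain i where i: "\<And>m. mdist (X m) (s m) (a i m) < e / 4"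
      using ex_a[OF s, of "e / 4"] e by auto
    have c0_mem: "c0 i \<in> mspace Z" and "(\<lambda>l. mdist Z (\<iota> l (a i (r l))) (c0 i)) \<longlonglongrightarrow> 0"
      using c0[of i] by (auto simp: limitin_mtopology_of)
    then have "\<forall>\<^sub>F l in sequentially. mdist Z (\<iota> l (a i (r l))) (c0 i) < e / 4"
      using e by (intro order_tendstoD(2)) auto
    then obtain N where N: "\<And>l. l \<ge> N \<Longrightarrow> mdist Z (\<iota> l (a i (r l))) (c0 i) < e / 4"
      by (auto simp: eventually_sequentially)
    have near: "mdist Z (\<iota> l (s (r l))) (c0 i) < e / 2" if "l \<ge> N" for l
    proof -
      have "mdist Z (\<iota> l (s (r l))) (c0 i)
          \<le> mdist Z (\<iota> l (s (r l))) (\<iota> l (a i (r l))) + mdist Z (\<iota> l (a i (r l))) (c0 i)"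
        by (intro mdist_triangle \<iota>_mem mem s a_mem c0_mem)
      then show ?thesis
        using N[OF that] i[of "r l"] by (simp add: \<iota>_dist mem s a_mem)
    qed
    have "mdist Z (\<iota> l (s (r l))) (\<iota> l' (s (r l'))) < e" if "l \<ge> N" "l' \<ge> N" for l l'
    proof -
      have "mdist Z (\<iota> l (s (r l))) (\<iota> l' (s (r l')))
          \<le> mdist Z (\<iota> l (s (r l))) (c0 i) + mdist Z (c0 i) (\<iota> l' (s (r l')))"
        by (intro mdist_triangle \<iota>_mem mem s c0_mem)
      then show ?thesis
        using near[OF that(1)] near[OF that(2)] by (simp add: mdist_commute)
    qed
    then show "\<exists>N. \<forall>l\<ge>N. \<forall>l'\<ge>N. mdist Z (\<iota> l (s (r l))) (\<iota> l' (s (r l'))) < e"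
      by blast
  qed blast
  then obtain c where c: "\<And>s. s \<in> S \<Longrightarrow> limitin (mtopology_of Z) (\<lambda>l. \<iota> l (s (r l))) (c s) sequentially"
    by metis
  have a_lim: "(\<lambda>l. mdist (X (r l)) (a i (r l)) (a j (r l))) \<longlonglongrightarrow> ?lim (a i) (a j)" for i j
  proof (rule LIM_zero_cancel, rule Lim_null_comparison[OF _ LIMSEQ_Suc[OF lim_1_over_n]])
    show "\<forall>\<^sub>F l in sequentially.
        norm (mdist (X (r l)) (a i (r l)) (a j (r l)) - ?lim (a i) (a j)) \<le> 1 / real (Suc l)"
      using eventually_ge_at_top[of "max i j"]
      by eventually_elim (use approx in simp)
  qed
  have "mdist Z (c s) (c t) = ?lim s t" if s: "s \<in> S" and t: "t \<in> S" for s t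
  proof -
    have lim: "(\<lambda>l. mdist (X (r l)) (s (r l)) (t (r l))) \<longlonglongrightarrow> mdist Z (c s) (c t)"
      using tendsto_mdist[OF c[OF s] c[OF t]] by (simp add: \<iota>_dist mem s t)
    have sb: "s \<in> bounded_seqs X p" and tb: "t \<in> bounded_seqs X p"
      using S s t by auto
    have "\<bar>mdist Z (c s) (c t) - ?lim s t\<bar> \<le> 0 + e" if "e > 0" for e
    proof -
      obtain i j where i: "\<And>m. mdist (X m) (s m) (a i m) < e / 4"
        and j: "\<And>m. mdist (X m) (t m) (a j m) < e / 4"
        using ex_a[OF s, of "e / 4"] ex_a[OF t, of "e / 4"] \<open>e > 0\<close> by auto
      have near: "\<bar>mdist (X m) (s m) (t m) - mdist (X m) (a i m) (a j m)\<bar> \<le> e / 2" for m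
        using abs_mdist_diff_le[of "s m" "X m" "t m" "a i m" "a j m"] i[of m] j[of m] mem s t a_mem
        by fastforce
      have "\<bar>mdist Z (c s) (c t) - ?lim (a i) (a j)\<bar> \<le> e / 2"
        by (rule tendsto_upperbound[OF tendsto_rabs[OF tendsto_diff[OF lim a_lim]]])
          (use near in simp_all)
      moreover have "\<bar>?lim s t - ?lim (a i) (a j)\<bar> \<le> e / 2"
        by (rule tendsto_upperbound[OF tendsto_rabs[OF tendsto_diff[OF
                ultra_dist_tendsto[OF \<omega> p sb tb] ultra_dist_tendsto[OF \<omega> p a a]]]
              _ ultra_not_bot[OF \<omega>]])
          (use near in simp)
      ultimately show ?thesis
        by linarith
    qed
    then have "\<bar>mdist Z (c s) (c t) - ?lim s t\<bar> \<le> 0"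
      by (rule field_le_epsilon)
    then show ?thesis
      by simp
  qed
  with r Z iso c that show ?thesis
    by blast
qed

section \<open>The compactness theorem for sequences of maps\<close>

theorem theorem1p6:
  fixes \<omega> :: "nat set \<Rightarrow> real"
    and I :: "'k set"
    and Y :: "'k \<Rightarrow> 'y metric"
    and X :: "nat \<Rightarrow> 'x metric"
    and p :: "nat \<Rightarrow> 'x"
    and f :: "'k \<Rightarrow> nat \<Rightarrow> 'y \<Rightarrow> 'x"
  assumes "nonprincipal_ultrafilter \<omega>"
    and "countable I"
    and "\<And>k. k \<in> I \<Longrightarrow> separable_space (mtopology_of (Y k))"
    and "\<And>m. mcomplete_of (X m)"
    and "\<And>m. p m \<in> mspace (X m)"
    and "\<And>k m. k \<in> I \<Longrightarrow> continuous_map (mtopology_of (Y k)) (mtopology_of (X m)) (f k m)"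
    and "\<And>k. k \<in> I \<Longrightarrow> equi_continuous (Y k) X (f k)"
    and "\<And>k. k \<in> I \<Longrightarrow> equi_bounded (Y k) X p (f k)"
  shows
    "(\<exists>(Z :: 'x common_point metric) (r :: nat \<Rightarrow> nat) \<iota> g.
        mcomplete_of Z \<and> strict_mono r \<and>
        (\<forall>l. isometric_embedding (X (r l)) Z (\<iota> l)) \<and>
        (\<forall>k\<in>I. continuous_map (mtopology_of (Y k)) (mtopology_of Z) (g k) \<and>
                converges_pointwise (Y k) Z (\<lambda>l. \<iota> l \<circ> f k (r l)) (g k) \<and>
                converges_uniformly_on_compacts (Y k) Z (\<lambda>l. \<iota> l \<circ> f k (r l)) (g k)) \<and>
        (\<exists>\<eta>. isometric_embedding
                (submetric Z (mtopology_of Z closure_of (\<Union>k\<in>I. g k ` mspace (Y k))))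
                (ultralimit \<omega> X p) \<eta> \<and>
              (\<forall>k\<in>I. \<forall>y\<in>mspace (Y k). pointwise_ultralimit \<omega> X p (f k) y = (\<eta> \<circ> g k) y))) \<and>
     (\<forall>F :: nat \<Rightarrow> nat set. decseq F \<and> (\<forall>n. \<omega> (F n) = 1) \<longrightarrow>
      (\<exists>(Z :: 'x common_point metric) (r :: nat \<Rightarrow> nat) \<iota> g.
        mcomplete_of Z \<and> strict_mono r \<and>
        (\<exists>N. strict_mono N \<and> (\<forall>l. r l \<in> F (N l))) \<and>
        (\<forall>l. isometric_embedding (X (r l)) Z (\<iota> l)) \<and>
        (\<forall>k\<in>I. continuous_map (mtopology_of (Y k)) (mtopology_of Z) (g k) \<and>
                converges_pointwise (Y k) Z (\<lambda>l. \<iota> l \<circ> f k (r l)) (g k) \<and>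
                converges_uniformly_on_compacts (Y k) Z (\<lambda>l. \<iota> l \<circ> f k (r l)) (g k)) \<and>
        (\<exists>\<eta>. isometric_embedding
                (submetric Z (mtopology_of Z closure_of (\<Union>k\<in>I. g k ` mspace (Y k))))
                (ultralimit \<omega> X p) \<eta> \<and>
              (\<forall>k\<in>I. \<forall>y\<in>mspace (Y k). pointwise_ultralimit \<omega> X p (f k) y = (\<eta> \<circ> g k) y))))"
  (is "?first \<and> (\<forall>F. decseq F \<and> (\<forall>n. \<omega> (F n) = 1) \<longrightarrow> ?second F)")
proof -
  note \<omega> = assms(1) and p = assms(5)
  let ?seq = "\<lambda>k y m. f k m y"
  \<comment> \<open>A point \<open>y\<close> of \<open>Y k\<close> is seen as the sequence of its images; all the maps \<open>f k\<close> are treated together.\<close>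
  define S where "S = (\<Union>k\<in>I. ?seq k ` mspace (Y k))"
  have f_mem: "f k m y \<in> mspace (X m)" if "k \<in> I" "y \<in> mspace (Y k)" for k m y
    using continuous_map_image_subset_topspace[OF assms(6)[OF that(1)], of m] that(2) by auto
  have bounded: "?seq k y \<in> bounded_seqs X p" if k: "k \<in> I" and y: "y \<in> mspace (Y k)" for k y
  proof -
    obtain L where L: "\<And>m. f k m ` mspace (Y k) \<subseteq> mcball_of (X m) (p m) L"
      using assms(8)[OF k] by (auto simp: equi_bounded_def)
    have "f k m y \<in> mcball_of (X m) (p m) L" for m
      using L[of m] y by blast
    then show ?thesis
      by (auto simp: bounded_seqs_def bdd_above_def mdist_commute)
  qed
  have "\<exists>C. countable C \<and> C \<subseteq> mspace (Y k) \<and> mtopology_of (Y k) closure_of C = mspace (Y k)"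
    if "k \<in> I" for k
    using assms(3)[OF that] by (simp add: separable_space_def)
  then obtain C where C: "\<And>k. k \<in> I \<Longrightarrow> countable (C k)" "\<And>k. k \<in> I \<Longrightarrow> C k \<subseteq> mspace (Y k)"
      "\<And>k. k \<in> I \<Longrightarrow> mtopology_of (Y k) closure_of C k = mspace (Y k)"
    by metis
  define D where "D = (\<Union>k\<in>I. ?seq k ` C k)"
  have D: "countable D" "D \<subseteq> bounded_seqs X p"
    using assms(2) C(1) bounded subsetD[OF C(2)] by (auto simp: D_def)
  have S: "S \<subseteq> bounded_seqs X p"
    using bounded by (auto simp: S_def)
  have dense: "\<exists>a\<in>D. \<forall>m. mdist (X m) (s m) (a m) < e" if "s \<in> S" "e > 0" for s e
  proof -
    obtain k y where k: "k \<in> I" and y: "y \<in> mspace (Y k)" and s: "s = ?seq k y"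
      using \<open>s \<in> S\<close> by (auto simp: S_def)
    obtain \<delta> where \<delta>: "\<delta> > 0" "\<And>x y m. x \<in> mspace (Y k) \<Longrightarrow> y \<in> mspace (Y k) \<Longrightarrow> mdist (Y k) x y < \<delta>
        \<Longrightarrow> mdist (X m) (f k m x) (f k m y) < e"
      using assms(7)[OF k] \<open>e > 0\<close> by (metis equi_continuous_def)
    have "y \<in> mtopology_of (Y k) closure_of C k"
      using C(3)[OF k] y by simp
    then obtain z where z: "z \<in> C k" "z \<in> mspace (Y k)" "mdist (Y k) y z < \<delta>"
      using \<delta>(1) by (auto simp: in_closure_of_mtopology_of)
    have "?seq k z \<in> D"
      using k z(1) by (auto simp: D_def)
    then show ?thesis
      using \<delta>(2)[OF y z(2,3)] by (intro bexI[of _ "?seq k z"]) (simp_all add: s)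
  qed
  have main: "?second F" if F: "\<And>n. \<omega> (F n) = 1" for F
  proof -
    obtain Z :: "'x common_point metric" and r \<iota> c where Z: "mcomplete_of Z"
      and r: "strict_mono r" "\<And>l. r l \<in> F l"
      and iso: "\<And>l. isometric_embedding (X (r l)) Z (\<iota> l)"
      and c: "\<And>s. s \<in> S \<Longrightarrow> limitin (mtopology_of Z) (\<lambda>l. \<iota> l (s (r l))) (c s) sequentially"
      and c_dist: "\<And>s t. s \<in> S \<Longrightarrow> t \<in> S \<Longrightarrow>
        mdist Z (c s) (c t) = ultra_lim \<omega> (\<lambda>m. mdist (X m) (s m) (t m))"
      by (rule ultralimit_common_space[where F = F, OF \<omega> p S D dense F]) blast+
    define g where "g k y = c (?seq k y)" for k y
    let ?h = "\<lambda>k l. \<iota> l \<circ> f k (r l)"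
    have pointwise: "converges_pointwise (Y k) Z (?h k) (g k)" if "k \<in> I" for k
      using c that by (auto simp: converges_pointwise_def g_def S_def)
    have h_mem: "?h k l y \<in> mspace Z" if "k \<in> I" "y \<in> mspace (Y k)" for k l y
      using iso[of l] f_mem[OF that, of "r l"] by (auto simp: isometric_embedding_def)
    have "mdist Z (?h k l x) (?h k l y) = mdist (X (r l)) (f k (r l) x) (f k (r l) y)"
      if "k \<in> I" "x \<in> mspace (Y k)" "y \<in> mspace (Y k)" for k l x y
      using iso[of l] f_mem that by (simp add: isometric_embedding_def)
    then have equi: "equi_continuous (Y k) (\<lambda>_. Z) (?h k)" if "k \<in> I" for k
      using assms(7)[OF that] that unfolding equi_continuous_def by metis
    note limits = equi_continuous_limit[OF equi h_mem pointwise]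
    have closure_eq: "(\<Union>k\<in>I. g k ` mspace (Y k)) = c ` S"
      by (auto simp: g_def S_def)
    have "c s \<in> mspace Z" if "s \<in> S" for s
      using c[OF that] by (simp add: limitin_mtopology_of)
    moreover have "ultra_class \<omega> X p s \<in> mspace (ultralimit \<omega> X p)" if "s \<in> S" for s
      using that S by (auto simp: mspace_ultralimit[OF \<omega> p] ultra_class_def intro!: quotientI)
    moreover have "mdist (ultralimit \<omega> X p) (ultra_class \<omega> X p s) (ultra_class \<omega> X p t) = mdist Z (c s) (c t)"
      if "s \<in> S" "t \<in> S" for s t
      using that S by (simp add: c_dist mdist_ultralimit[OF \<omega> p] subset_iff)
    ultimately obtain \<eta> where
      \<eta>: "isometric_embedding (submetric Z (mtopology_of Z closure_of (c ` S))) (ultralimit \<omega> X p) \<eta>"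
        "\<And>s. s \<in> S \<Longrightarrow> \<eta> (c s) = ultra_class \<omega> X p s"
      using isometry_extends_to_closure[of "ultralimit \<omega> X p" S c Z "ultra_class \<omega> X p"]
        mcomplete_ultralimit[of \<omega> p X, OF \<omega> p] by blast
    have \<eta>_g: "pointwise_ultralimit \<omega> X p (f k) y = (\<eta> \<circ> g k) y" if "k \<in> I" "y \<in> mspace (Y k)" for k y
    proof -
      have "?seq k y \<in> S"
        using that by (auto simp: S_def)
      then show ?thesis
        by (simp add: pointwise_ultralimit_def g_def \<eta>(2))
    qed
    have N: "\<exists>N. strict_mono N \<and> (\<forall>l. r l \<in> F (N l))"
      using r(2) by (intro exI[of _ id]) (simp add: strict_mono_def)
    show ?thesis
      by (rule exI[of _ Z], rule exI[of _ r], rule exI[of _ \<iota>], rule exI[of _ g])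
        (use Z r(1) N iso limits pointwise \<eta>(1) \<eta>_g in \<open>unfold closure_eq, blast\<close>)
  qed
  \<comment> \<open>Without prescribed sets, the whole index set is taken at every step.\<close>
  have "?second (\<lambda>_. UNIV)"
    using ultra_UNIV[OF \<omega>] by (intro main)
  then have ?first
    by (elim exE conjE) (intro exI conjI; assumption)
  then show ?thesis
    using main by simp
qed

end
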